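(* Let $\Gamma$ be a finite regular graph of valency at least $4$, and suppose there is a finite solvable group $G$ acting on $\Gamma$ by automorphisms such that $\Gamma$ is $G$-arc-transitive. Then $\Gamma$ admits a nowhere-zero $3$-flow.
   Context: All graphs are finite and undirected. Given an orientation of a graph $\Gamma$ and an integer $k\ge 2$, a $k$-flow is a function $f:E(\Gamma)\to\{0,\pm1,\dots,\pm(k-1)\}$ such that for every vertex $v$, the sum of $f(e)$ over edges $e$ with tail $v$ equals the sum of $f(e)$ over edges $e$ with head $v$. It is nowhere-zero if $f(e)\neq 0$ for all $e$; the existence of a nowhere-zero $k$-flow does not depend on the chosen orientation. A group $G$ acts on $\Gamma$ by automorphisms if it acts on $V(\Gamma)$ (not necessarily faithfully) preserving adjacency and non-adjacency. $\Gamma$ is $G$-arc-transitive if $G$ is transitive on $V(\Gamma)$ and on the set of arcs (ordered pairs of adjacent vertices) of $\Gamma$. *)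

theory Defs
  imports "HOL-Algebra.Group_Action" "HOL-Algebra.Solvable_Groups"
begin

definition simple_graph :: "'v set \<Rightarrow> ('v \<Rightarrow> 'v \<Rightarrow> bool) \<Rightarrow> bool" where
  "simple_graph V Adj \<longleftrightarrow>
     (\<forall>u v. Adj u v \<longrightarrow> u \<in> V \<and> v \<in> V) \<and>
     (\<forall>u v. Adj u v \<longrightarrow> Adj v u) \<and> (\<forall>v. \<not> Adj v v)"

definition neighbours :: "'v set \<Rightarrow> ('v \<Rightarrow> 'v \<Rightarrow> bool) \<Rightarrow> 'v \<Rightarrow> 'v set" where
  "neighbours V Adj v = {u \<in> V. Adj v u}"

definition regular_graph :: "'v set \<Rightarrow> ('v \<Rightarrow> 'v \<Rightarrow> bool) \<Rightarrow> nat \<Rightarrow> bool" where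
  "regular_graph V Adj k \<longleftrightarrow> (\<forall>v\<in>V. card (neighbours V Adj v) = k)"

definition arcs :: "'v set \<Rightarrow> ('v \<Rightarrow> 'v \<Rightarrow> bool) \<Rightarrow> ('v \<times> 'v) set" where
  "arcs V Adj = {(u, v). u \<in> V \<and> v \<in> V \<and> Adj u v}"

definition acts_by_automorphisms ::
  "('g, 'b) monoid_scheme \<Rightarrow> 'v set \<Rightarrow> ('v \<Rightarrow> 'v \<Rightarrow> bool) \<Rightarrow> ('g \<Rightarrow> 'v \<Rightarrow> 'v) \<Rightarrow> bool" where
  "acts_by_automorphisms G V Adj \<phi> \<longleftrightarrow>
     group_action G V \<phi> \<and>
     (\<forall>g\<in>carrier G. \<forall>u\<in>V. \<forall>v\<in>V. Adj u v \<longleftrightarrow> Adj (\<phi> g u) (\<phi> g v))"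

definition arc_transitive ::
  "('g, 'b) monoid_scheme \<Rightarrow> 'v set \<Rightarrow> ('v \<Rightarrow> 'v \<Rightarrow> bool) \<Rightarrow> ('g \<Rightarrow> 'v \<Rightarrow> 'v) \<Rightarrow> bool" where
  "arc_transitive G V Adj \<phi> \<longleftrightarrow>
     (\<forall>u\<in>V. \<forall>v\<in>V. \<exists>g\<in>carrier G. \<phi> g u = v) \<and>
     (\<forall>a\<in>arcs V Adj. \<forall>b\<in>arcs V Adj. \<exists>g\<in>carrier G. (\<phi> g (fst a), \<phi> g (snd a)) = b)"

text \<open>An orientation: a set D of arcs containing exactly one of (u,v), (v,u) for each edge;
  the arc (u,v) in D is the edge with tail u and head v.\<close>
definition orientation :: "'v set \<Rightarrow> ('v \<Rightarrow> 'v \<Rightarrow> bool) \<Rightarrow> ('v \<times> 'v) set \<Rightarrow> bool" where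
  "orientation V Adj D \<longleftrightarrow> D \<subseteq> arcs V Adj \<and>
     (\<forall>(u, v)\<in>arcs V Adj. ((u, v) \<in> D) \<noteq> ((v, u) \<in> D))"

definition k_flow :: "nat \<Rightarrow> 'v set \<Rightarrow> ('v \<times> 'v) set \<Rightarrow> ('v \<times> 'v \<Rightarrow> int) \<Rightarrow> bool" where
  "k_flow k V D f \<longleftrightarrow>
     (\<forall>e\<in>D. \<bar>f e\<bar> \<le> int k - 1) \<and>
     (\<forall>v\<in>V. (\<Sum>e\<in>{e\<in>D. fst e = v}. f e) = (\<Sum>e\<in>{e\<in>D. snd e = v}. f e))"

definition nowhere_zero_k_flow :: "nat \<Rightarrow> 'v set \<Rightarrow> ('v \<times> 'v) set \<Rightarrow> ('v \<times> 'v \<Rightarrow> int) \<Rightarrow> bool" where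
  "nowhere_zero_k_flow k V D f \<longleftrightarrow> k_flow k V D f \<and> (\<forall>e\<in>D. f e \<noteq> 0)"

definition admits_nz_flow :: "nat \<Rightarrow> 'v set \<Rightarrow> ('v \<Rightarrow> 'v \<Rightarrow> bool) \<Rightarrow> bool" where
  "admits_nz_flow k V Adj \<longleftrightarrow>
     (\<exists>D f. orientation V Adj D \<and> nowhere_zero_k_flow k V D f)"

end

theory Submission
  imports Defs "HOL-Library.Transitive_Closure_Table"
begin

text \<open>
  A nowhere-zero 3-flow is handled as an antisymmetric integer function on pairs of vertices, so that
  flows on edge-disjoint subgraphs can be glued. Rounding a fractional flow to an integral one gives
  such flows for graphs with even degrees and for regular bipartite graphs of valency at least 2.

  Let the valency k be odd, and let N be the last term of the derived series of G whose orbits do not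
  give a quotient of the same valency, with H = [N, N] the next term. If edges run between different
  N-orbits, then two adjacent N-orbits span a regular bipartite graph of valency at least 2, and the
  flows on these graphs are glued. Otherwise all edges lie inside N-orbits, on whose H-quotients N
  acts as an abelian group, that is, the quotients are Cayley graphs of abelian groups. Since k is odd
  some connecting element is an involution, hence by arc-transitivity all of them are, and N-orbits on
  edges are perfect matchings. As k is at least 5, three involutions a, b, c with c different from ab
  can be chosen; their matchings form a bipartite cubic graph, and the remaining degrees are even.
\<close>

section \<open>Rounding a fractional flow to an integral one\<close>

text \<open>An arc with \<open>q * g x y < h x y\<close> is residual: \<open>g x y\<close> can grow
  by one and stay at distance less than one from \<open>h x y / q\<close>. One unit added along a
  simple path of such arcs affects the divergence at its ends only. That rows off the path are
  untouched is what keeps the first arc residual in the induction.\<close>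

lemma push_along_path:
  fixes g h :: "'v \<Rightarrow> 'v \<Rightarrow> int" and q :: int
  assumes "rtrancl_path (\<lambda>x y. q * g x y < h x y) v xs w"
    and "distinct (v # xs)" and "set (v # xs) \<subseteq> V" and "finite V"
    and g_anti: "\<And>x y. g y x = - g x y" and h_anti: "\<And>x y. h y x = - h x y"
    and near: "\<And>x y. \<bar>q * g x y - h x y\<bar> < q"
  shows "\<exists>g'. (\<forall>x y. g' y x = - g' x y) \<and> (\<forall>x y. \<bar>q * g' x y - h x y\<bar> < q) \<and>
    (\<forall>x y. x \<notin> set (v # xs) \<longrightarrow> g' x y = g x y) \<and>
    (\<forall>x\<in>V. (\<Sum>y\<in>V. g' x y) = (\<Sum>y\<in>V. g x y) + (if x = v then 1 else 0) - (if x = w then 1 else 0))"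
  using assms(1-3)
proof (induction rule: rtrancl_path.induct)
  case (base x)
  show ?case by (rule exI[of _ g]) (intro conjI allI ballI g_anti near, simp_all)
next
  case (step x y ys z)
  then have "distinct (y # ys)" "set (y # ys) \<subseteq> V" by auto
  from step.IH[OF this] obtain g' where anti: "\<And>a b. g' b a = - g' a b"
    and near': "\<And>a b. \<bar>q * g' a b - h a b\<bar> < q"
    and off: "\<And>a b. a \<notin> set (y # ys) \<Longrightarrow> g' a b = g a b"
    and bal: "\<And>a. a \<in> V \<Longrightarrow> (\<Sum>b\<in>V. g' a b) =
        (\<Sum>b\<in>V. g a b) + (if a = y then 1 else 0) - (if a = z then 1 else 0)"
    by blast
  have xy: "x \<noteq> y" "x \<in> V" "y \<in> V" and x_off: "x \<notin> set (y # ys)" using step.prems by auto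
  define g'' where "g'' a b = g' a b + (if a = x \<and> b = y then 1 else 0)
      - (if a = y \<and> b = x then 1 else (0::int))" for a b
  have "g'' b a = - g'' a b" for a b
    using anti[of a b] xy by (auto simp: g''_def)
  moreover have "\<bar>q * g'' a b - h a b\<bar> < q" for a b
  proof -
    \<comment> \<open>Residuality puts \<open>q * g' x y - h x y\<close> strictly between
      \<open>-q\<close> and 0, so adding \<open>q\<close> lands between 0 and
      \<open>q\<close>.\<close>
    have "\<bar>q * g' x y + q - h x y\<bar> < q"
      using step.hyps(1) near'[of x y] off[OF x_off] by simp
    moreover have "\<bar>q * g' y x - q - h y x\<bar> < q"
      using calculation anti[of x y] h_anti[of x y] by simp
    ultimately show ?thesis
      using near'[of a b] xy by (auto simp: g''_def algebra_simps)
  qed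
  moreover have "g'' a b = g a b" if "a \<notin> set (x # y # ys)" for a b
    using off that by (auto simp: g''_def)
  moreover have "(\<Sum>b\<in>V. g'' a b) =
      (\<Sum>b\<in>V. g a b) + (if a = x then 1 else 0) - (if a = z then 1 else 0)" if "a \<in> V" for a
  proof -
    have *: "(\<Sum>b\<in>V. if a = c \<and> b = d then 1 else (0::int)) = (if a = c then 1 else 0)"
      if "d \<in> V" for c d
      using that \<open>finite V\<close> by (cases "a = c") (auto simp: sum.delta')
    show ?thesis
      unfolding g''_def sum.distrib sum_subtractf *[OF xy(2)] *[OF xy(3)] bal[OF that] by simp
  qed
  ultimately show ?case by (intro exI[of _ g'']) blast
qed

lemma antisym_sum_zero:
  fixes h :: "'v \<Rightarrow> 'v \<Rightarrow> int"
  assumes "\<And>x y. h y x = - h x y"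
  shows "(\<Sum>x\<in>V. \<Sum>y\<in>V. h x y) = 0"
proof -
  have "(\<Sum>x\<in>V. \<Sum>y\<in>V. h x y) = (\<Sum>y\<in>V. \<Sum>x\<in>V. - h y x)"
    by (subst sum.swap) (intro sum.cong refl assms)
  then show ?thesis by (simp add: sum_negf)
qed

text \<open>Here \<open>h / q\<close> is the fractional flow and \<open>b\<close> its integral
  divergence. As in max-flow min-cut, take an integral candidate of least total absolute excess
  \<open>tot\<close>: if some excess remains, either a residual path improves the candidate or the
  set reachable by residual arcs contradicts a cut identity.\<close>

lemma integral_flow_rounding:
  fixes h :: "'v \<Rightarrow> 'v \<Rightarrow> int" and q :: int and b :: "'v \<Rightarrow> int"
  assumes fin: "finite V" and q: "q > 0"
    and h_anti: "\<And>x y. h y x = - h x y"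
    and h_bal: "\<And>x. x \<in> V \<Longrightarrow> (\<Sum>y\<in>V. h x y) = q * b x"
  obtains g where "\<And>x y. g y x = - g x y" "\<And>x y. \<bar>q * g x y - h x y\<bar> < q"
    "\<And>x. x \<in> V \<Longrightarrow> (\<Sum>y\<in>V. g x y) = b x"
proof -
  define ok where "ok g \<longleftrightarrow> (\<forall>x y. g y x = - g x y) \<and> (\<forall>x y. \<bar>q * g x y - h x y\<bar> < q)" for g
  define ex where "ex g x = (\<Sum>y\<in>V. g x y) - b x" for g :: "'v \<Rightarrow> 'v \<Rightarrow> int" and x
  define tot where "tot g = nat (\<Sum>x\<in>V. \<bar>ex g x\<bar>)" for g
  \<comment> \<open>Truncation toward zero serves as a first candidate: unlike floor division it is
    an odd function, as antisymmetry demands.\<close>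
  have "ok (\<lambda>x y. if h x y \<ge> 0 then h x y div q else - ((- h x y) div q))"
  proof -
    have *: "\<bar>q * (a div q) - a\<bar> < q" for a
      using q pos_mod_bound[of q a] pos_mod_sign[of q a] minus_mult_div_eq_mod[of a q] by linarith
    have **: "\<bar>q * - (- a div q) - a\<bar> < q" for a
      using *[of "-a"] by (simp add: algebra_simps abs_minus_commute)
    have anti: "(if h y x \<ge> 0 then h y x div q else - ((- h y x) div q)) =
        - (if h x y \<ge> 0 then h x y div q else - ((- h x y) div q))" for x y
      unfolding h_anti[of x y] by simp
    show ?thesis unfolding ok_def
    proof (intro conjI allI)
      fix x y
      show "\<bar>q * (if h x y \<ge> 0 then h x y div q else - ((- h x y) div q)) - h x y\<bar> < q"
        using *[of "h x y"] **[of "h x y"] by presburger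
    qed (rule anti)
  qed
  then obtain g where g: "ok g" and least: "\<And>g'. ok g' \<Longrightarrow> tot g \<le> tot g'"
    using ex_has_least_nat[of ok _ tot] by blast
  have g_anti: "\<And>x y. g y x = - g x y" and near: "\<And>x y. \<bar>q * g x y - h x y\<bar> < q"
    using g unfolding ok_def by blast+
  have "q * (\<Sum>x\<in>V. b x) = 0"
    using antisym_sum_zero[of h V, OF h_anti] h_bal by (simp add: sum_distrib_left)
  then have ex_sum: "(\<Sum>x\<in>V. ex g x) = 0"
    using antisym_sum_zero[of g V, OF g_anti] q by (simp add: ex_def sum_subtractf)
  have "ex g x = 0" if x: "x \<in> V" for x
  proof (rule ccontr)
    assume "ex g x \<noteq> 0"
    \<comment> \<open>The excesses sum to 0, so a nonzero one forces a negative one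
      somewhere.\<close>
    then obtain v where v: "v \<in> V" "ex g v < 0"
      using ex_sum fin x sum_nonneg_eq_0_iff[of V "ex g"] by (meson not_less)
    define res where "res = (\<lambda>x y. q * g x y < h x y)"
    define R where "R = {w. (\<lambda>x y. res x y \<and> x \<in> V \<and> y \<in> V)\<^sup>*\<^sup>* v w}"
    have R_V: "R \<subseteq> V"
    proof
      fix w assume "w \<in> R"
      then have "(\<lambda>x y. res x y \<and> x \<in> V \<and> y \<in> V)\<^sup>*\<^sup>* v w" by (simp add: R_def)
      then show "w \<in> V" by (induction) (use v in auto)
    qed
    have R_nonpos: "ex g w \<le> 0" if w: "w \<in> R" for w
    proof (rule ccontr)
      assume w_pos: "\<not> ex g w \<le> 0"
      obtain xs where "rtrancl_path (\<lambda>x y. res x y \<and> x \<in> V \<and> y \<in> V) v xs w"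
        using w unfolding R_def rtranclp_eq_rtrancl_path by blast
      then obtain xs where xs: "rtrancl_path (\<lambda>x y. res x y \<and> x \<in> V \<and> y \<in> V) v xs w"
        "distinct (v # xs)"
        by (rule rtrancl_path_distinct)
      have xs_V: "set (v # xs) \<subseteq> V"
        using xs(1) v(1) by (induction) auto
      have path: "rtrancl_path res v xs w"
        using xs(1) by (induction) (auto intro: rtrancl_path.intros)
      obtain g' where g': "ok g'"
        "\<And>x. x \<in> V \<Longrightarrow> (\<Sum>y\<in>V. g' x y) =
          (\<Sum>y\<in>V. g x y) + (if x = v then 1 else 0) - (if x = w then 1 else 0)"
        using push_along_path[OF path[unfolded res_def] xs(2) xs_V fin, OF g_anti h_anti near]
        unfolding ok_def by blast
      have "w \<in> V" "w \<noteq> v" using R_V w v w_pos by auto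
      \<comment> \<open>The unit pushed raises a negative excess and lowers a positive one, so
        \<open>tot\<close> drops, against minimality.\<close>
      then have "(\<Sum>x\<in>V. \<bar>ex g' x\<bar>) < (\<Sum>x\<in>V. \<bar>ex g x\<bar>)"
        using v w_pos g'(2) fin by (intro sum_strict_mono_ex1) (auto simp: ex_def)
      moreover have "0 \<le> (\<Sum>x\<in>V. \<bar>ex g' x\<bar>)" by (simp add: sum_nonneg)
      ultimately have "tot g' < tot g" unfolding tot_def by linarith
      with least[OF g'(1)] show False by simp
    qed
    have fin_R: "finite R" using R_V fin finite_subset by blast
    have "v \<in> R" by (simp add: R_def)
    then have "(\<Sum>x\<in>R. ex g x) < 0"
      using sum_strict_mono_ex1[OF fin_R, of "ex g" "\<lambda>_. 0"] R_nonpos v(2) by auto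
    moreover have "(\<Sum>x\<in>R. ex g x) \<ge> 0"
    proof -
      \<comment> \<open>No residual arc leaves \<open>R\<close>, so \<open>d\<close> is nonnegative
        from \<open>R\<close> to \<open>V - R\<close>; within \<open>R\<close> it cancels by
        antisymmetry. The total over \<open>R\<close> is \<open>q\<close> times the excess of
        \<open>R\<close>.\<close>
      define d where "d x y = q * g x y - h x y" for x y
      have "d x y \<ge> 0" if "x \<in> R" "y \<in> V - R" for x y
      proof (rule ccontr)
        assume "\<not> d x y \<ge> 0"
        then have "res x y \<and> x \<in> V \<and> y \<in> V" using that R_V by (auto simp: d_def res_def)
        moreover have "(\<lambda>x y. res x y \<and> x \<in> V \<and> y \<in> V)\<^sup>*\<^sup>* v x"
          using that(1) by (simp add: R_def)
        ultimately have "y \<in> R"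
          unfolding R_def by (auto intro: rtranclp.rtrancl_into_rtrancl)
        with that show False by simp
      qed
      then have "0 \<le> (\<Sum>x\<in>R. \<Sum>y\<in>V - R. d x y)" by (intro sum_nonneg) auto
      also have "\<dots> = (\<Sum>x\<in>R. \<Sum>y\<in>V - R. d x y) + (\<Sum>x\<in>R. \<Sum>y\<in>R. d x y)"
      proof -
        have "d y x = - d x y" for x y
          using g_anti[of x y] h_anti[of x y] by (simp add: d_def)
        from antisym_sum_zero[of d R, OF this] show ?thesis by simp
      qed
      also have "\<dots> = (\<Sum>x\<in>R. \<Sum>y\<in>V. d x y)"
        by (simp only: sum.subset_diff[OF R_V fin] sum.distrib)
      also have "\<dots> = (\<Sum>x\<in>R. q * ex g x)"
        using h_bal R_V
        by (intro sum.cong) (auto simp: d_def ex_def sum_subtractf sum_distrib_left[symmetric] right_diff_distrib)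
      also have "\<dots> = q * (\<Sum>x\<in>R. ex g x)" by (simp add: sum_distrib_left)
      finally show ?thesis using q by (simp add: zero_le_mult_iff)
    qed
    ultimately show False by simp
  qed
  then show thesis using that[OF g_anti near] by (simp add: ex_def)
qed

section \<open>Antisymmetric flows and their gluing\<close>

text \<open>\<open>f x y\<close> is the net flow from \<open>x\<close> to \<open>y\<close>. Values
  off the edges are unconstrained, and the balance ignores them, so a flow on a subgraph need not be
  cut down before gluing.\<close>

definition nz3_flowable :: "'v set \<Rightarrow> ('v \<Rightarrow> 'v \<Rightarrow> bool) \<Rightarrow> bool" where
  "nz3_flowable V E \<longleftrightarrow> (\<exists>f :: 'v \<Rightarrow> 'v \<Rightarrow> int. (\<forall>x y. f y x = - f x y) \<and>
     (\<forall>x\<in>V. \<forall>y\<in>V. E x y \<longrightarrow> f x y \<noteq> 0 \<and> \<bar>f x y\<bar> \<le> 2) \<and>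
     (\<forall>x\<in>V. (\<Sum>y\<in>neighbours V E x. f x y) = 0))"

lemma nz3_flowableI:
  fixes f :: "'v \<Rightarrow> 'v \<Rightarrow> int"
  assumes "\<And>x y. f y x = - f x y"
    and "\<And>x y. x \<in> V \<Longrightarrow> y \<in> V \<Longrightarrow> E x y \<Longrightarrow> f x y \<noteq> 0 \<and> \<bar>f x y\<bar> \<le> 2"
    and "\<And>x. x \<in> V \<Longrightarrow> (\<Sum>y\<in>neighbours V E x. f x y) = 0"
  shows "nz3_flowable V E"
  unfolding nz3_flowable_def using assms by blast

lemma sum_neighbours:
  fixes f :: "'v \<Rightarrow> int"
  assumes "finite V" and "\<And>y. y \<in> V \<Longrightarrow> \<not> E x y \<Longrightarrow> f y = 0"
  shows "(\<Sum>y\<in>neighbours V E x. f y) = (\<Sum>y\<in>V. f y)"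
  using assms by (intro sum.mono_neutral_left) (auto simp: neighbours_def)

text \<open>Directing each edge so that its value is positive turns the positive values at a vertex
  into its outflow and the negated negative ones into its inflow.\<close>

lemma admits_nz_flow_if_nz3_flowable:
  assumes fin: "finite V" and "simple_graph V Adj" and "nz3_flowable V Adj"
  shows "admits_nz_flow 3 V Adj"
proof -
  obtain f :: "'a \<Rightarrow> 'a \<Rightarrow> int" where anti: "\<And>x y. f y x = - f x y"
    and nz: "\<And>x y. x \<in> V \<Longrightarrow> y \<in> V \<Longrightarrow> Adj x y \<Longrightarrow> f x y \<noteq> 0 \<and> \<bar>f x y\<bar> \<le> 2"
    and bal: "\<And>x. x \<in> V \<Longrightarrow> (\<Sum>y\<in>neighbours V Adj x. f x y) = 0"
    using assms(3) unfolding nz3_flowable_def by blast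
  have sym: "Adj x y \<Longrightarrow> Adj y x" for x y using assms(2) by (auto simp: simple_graph_def)
  define D where "D = {(x, y). x \<in> V \<and> y \<in> V \<and> Adj x y \<and> f x y > 0}"
  define F where "F = (\<lambda>(x, y). f x y)"
  have "orientation V Adj D"
    unfolding orientation_def
  proof (intro conjI ballI, goal_cases)
    case 1
    show ?case by (auto simp: D_def arcs_def)
  next
    case (2 e)
    obtain u v where e: "e = (u, v)" by (cases e)
    have "u \<in> V" "v \<in> V" "Adj u v" "Adj v u" using 2 sym by (auto simp: e arcs_def)
    then show ?case using nz[of u v] anti[of u v] by (simp add: D_def e) linarith
  qed
  moreover have "(\<Sum>e\<in>{e\<in>D. fst e = v}. F e) = (\<Sum>e\<in>{e\<in>D. snd e = v}. F e)" if v: "v \<in> V" for v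
  proof -
    let ?P = "{y\<in>neighbours V Adj v. f v y > 0}" and ?N = "{y\<in>neighbours V Adj v. \<not> f v y > 0}"
    have finN: "finite (neighbours V Adj v)" using fin by (simp add: neighbours_def)
    have P: "{e\<in>D. fst e = v} = Pair v ` ?P"
      using v by (auto simp: D_def neighbours_def)
    have N: "{e\<in>D. snd e = v} = (\<lambda>y. (y, v)) ` ?N"
    proof -
      have "{e\<in>D. snd e = v} = (\<lambda>y. (y, v)) ` {y. y \<in> V \<and> Adj y v \<and> f y v > 0}"
        using v by (auto simp: D_def)
      moreover have "y \<in> V \<and> Adj y v \<and> f y v > 0 \<longleftrightarrow> y \<in> ?N" for y
        using v nz[of v y] sym[of v y] sym[of y v] anti[of v y] by (auto simp: neighbours_def)
      ultimately show ?thesis by blast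
    qed
    have "(\<Sum>y\<in>?P. f v y) + (\<Sum>y\<in>?N. f v y) = 0"
    proof -
      have "neighbours V Adj v = ?P \<union> ?N" by auto
      then have "(\<Sum>y\<in>?P \<union> ?N. f v y) = 0" using bal[OF v] by simp
      then show ?thesis using finN by (subst (asm) sum.union_disjoint) auto
    qed
    moreover have "(\<Sum>y\<in>?N. f y v) = - (\<Sum>y\<in>?N. f v y)"
      unfolding sum_negf[symmetric] by (intro sum.cong refl anti)
    ultimately show ?thesis
      unfolding P N by (simp add: sum.reindex inj_on_def F_def o_def)
  qed
  moreover have "\<forall>e\<in>D. \<bar>F e\<bar> \<le> int 3 - 1" "\<forall>e\<in>D. F e \<noteq> 0"
    using nz by (fastforce simp: D_def F_def)+
  ultimately show ?thesis
    unfolding admits_nz_flow_def nowhere_zero_k_flow_def k_flow_def by blast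
qed

text \<open>Each edge takes its value from the flow of its own class, and the balance at a vertex
  splits into one vanishing sum per label.\<close>

lemma nz3_flowable_edge_partition:
  assumes fin: "finite V" and label_sym: "\<And>x y. label y x = label x y"
    and "\<And>c. nz3_flowable V (\<lambda>x y. E x y \<and> label x y = c)"
  shows "nz3_flowable V E"
proof -
  define ok where "ok c f \<longleftrightarrow> (\<forall>x y. f y x = - f x y) \<and>
     (\<forall>x\<in>V. \<forall>y\<in>V. E x y \<and> label x y = c \<longrightarrow> f x y \<noteq> 0 \<and> \<bar>f x y\<bar> \<le> 2) \<and>
     (\<forall>x\<in>V. (\<Sum>y\<in>neighbours V (\<lambda>x y. E x y \<and> label x y = c) x. f x y) = 0)"
    for c and f :: "'a \<Rightarrow> 'a \<Rightarrow> int"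
  have "\<forall>c. \<exists>f. ok c f"
    using assms(3) unfolding nz3_flowable_def ok_def by blast
  then obtain F where F: "\<And>c. ok c (F c)" by metis
  have anti: "F c y x = - F c x y" for c x y
    using F[of c] unfolding ok_def by blast
  have nz: "F (label x y) x y \<noteq> 0 \<and> \<bar>F (label x y) x y\<bar> \<le> 2" if "x \<in> V" "y \<in> V" "E x y" for x y
    using F[of "label x y"] that unfolding ok_def by blast
  have bal: "(\<Sum>y\<in>neighbours V (\<lambda>x y. E x y \<and> label x y = c) x. F c x y) = 0"
    if "x \<in> V" for c x
    using F[of c] that unfolding ok_def by blast
  show ?thesis
  proof (rule nz3_flowableI[where f = "\<lambda>x y. F (label x y) x y"])
    show "F (label y x) y x = - F (label x y) x y" for x y
      unfolding label_sym[of y x] by (rule anti)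
  next
    fix x assume x: "x \<in> V"
    have "(\<Sum>y\<in>neighbours V E x. F (label x y) x y) =
        (\<Sum>c\<in>label x ` neighbours V E x. \<Sum>y\<in>{y\<in>neighbours V E x. label x y = c}. F (label x y) x y)"
      by (rule sum.image_gen) (simp add: neighbours_def fin)
    also have "\<dots> = 0"
    proof (rule sum.neutral, rule ballI)
      fix c
      have "{y\<in>neighbours V E x. label x y = c} = neighbours V (\<lambda>x y. E x y \<and> label x y = c) x"
        by (auto simp: neighbours_def)
      moreover have "(\<Sum>y\<in>{y\<in>neighbours V E x. label x y = c}. F (label x y) x y) =
          (\<Sum>y\<in>{y\<in>neighbours V E x. label x y = c}. F c x y)"
        by (intro sum.cong) auto
      ultimately show "(\<Sum>y\<in>{y\<in>neighbours V E x. label x y = c}. F (label x y) x y) = 0"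
        using bal[OF x, of c] by simp
    qed
    finally show "(\<Sum>y\<in>neighbours V E x. F (label x y) x y) = 0" .
  qed (use nz in blast)
qed

section \<open>Graphs with even degrees and regular bipartite graphs\<close>

text \<open>An arbitrary orientation \<open>h\<close> with values 1 and -1 has even divergence
  everywhere, so \<open>h / 2\<close> rounds to an integral \<open>g\<close> of the same divergence.
  Then \<open>h - 2 * g\<close> is balanced and, on edges, odd and below 2 in absolute value: an
  Eulerian orientation.\<close>

lemma nz3_flowable_even_degrees:
  assumes fin: "finite V" and sym: "\<And>x y. E x y \<Longrightarrow> E y x" and irrefl: "\<And>x. \<not> E x x"
    and deg: "\<And>x. x \<in> V \<Longrightarrow> even (card (neighbours V E x))"
  shows "nz3_flowable V E"
proof -
  obtain rank :: "'a \<Rightarrow> nat" where rank: "inj_on rank V"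
    using finite_imp_inj_to_nat_seg[OF fin] by blast
  define h :: "'a \<Rightarrow> 'a \<Rightarrow> int" where
    "h x y = (if x \<in> V \<and> y \<in> V \<and> E x y then if rank x < rank y then 1 else - 1 else 0)" for x y
  have h_anti: "h y x = - h x y" for x y
  proof (cases "x \<in> V \<and> y \<in> V \<and> E x y")
    case True
    then have "rank x \<noteq> rank y" using rank irrefl by (metis inj_on_eq_iff)
    then show ?thesis using True sym[of x y] by (auto simp: h_def)
  next
    case False
    then show ?thesis using sym[of y x] by (auto simp: h_def)
  qed
  have "even (\<Sum>y\<in>V. h x y)" if x: "x \<in> V" for x
  proof -
    have "(\<Sum>y\<in>V. h x y) = (\<Sum>y\<in>neighbours V E x. h x y)"
      using fin by (intro sum_neighbours[symmetric]) (auto simp: h_def)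
    also have "even \<dots> \<longleftrightarrow> even (card {y\<in>neighbours V E x. odd (h x y)})"
      using fin by (intro even_sum_iff) (simp add: neighbours_def)
    also have "{y\<in>neighbours V E x. odd (h x y)} = neighbours V E x"
      using x by (auto simp: neighbours_def h_def)
    finally show ?thesis using deg[OF x] by simp
  qed
  then have h_bal: "(\<Sum>y\<in>V. h x y) = 2 * ((\<Sum>y\<in>V. h x y) div 2)" if "x \<in> V" for x
    using that by simp
  obtain g where g: "\<And>x y. g y x = - g x y" "\<And>x y. \<bar>2 * g x y - h x y\<bar> < 2"
      "\<And>x. x \<in> V \<Longrightarrow> (\<Sum>y\<in>V. g x y) = (\<Sum>y\<in>V. h x y) div 2"
    using integral_flow_rounding[of V 2 h, OF fin zero_less_numeral h_anti h_bal] by blast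
  show ?thesis
  proof (rule nz3_flowableI[where f = "\<lambda>x y. h x y - 2 * g x y"])
    show "h y x - 2 * g y x = - (h x y - 2 * g x y)" for x y
      using h_anti[of x y] g(1)[of x y] by simp
  next
    fix x y assume "x \<in> V" "y \<in> V" "E x y"
    then have "odd (h x y)" by (simp add: h_def)
    then have "h x y - 2 * g x y \<noteq> 0" by presburger
    then show "h x y - 2 * g x y \<noteq> 0 \<and> \<bar>h x y - 2 * g x y\<bar> \<le> 2" using g(2)[of x y] by linarith
  next
    fix x assume x: "x \<in> V"
    have "(\<Sum>y\<in>neighbours V E x. h x y - 2 * g x y) = (\<Sum>y\<in>V. h x y - 2 * g x y)"
    proof (rule sum_neighbours[OF fin])
      fix y assume "\<not> E x y"
      then show "h x y - 2 * g x y = 0" using g(2)[of x y] by (simp add: h_def)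
    qed
    also have "\<dots> = 0"
      using h_bal[OF x] g(3)[OF x] by (simp add: sum_subtractf sum_distrib_left[symmetric])
    finally show "(\<Sum>y\<in>neighbours V E x. h x y - 2 * g x y) = 0" .
  qed
qed

lemma bipartite_regular_factor:
  fixes s :: "'v \<Rightarrow> int" and m d :: nat
  assumes fin: "finite V" and sym: "\<And>x y. E x y \<Longrightarrow> E y x"
    and s: "\<And>x. s x = 1 \<or> s x = - 1" and bip: "\<And>x y. x \<in> V \<Longrightarrow> y \<in> V \<Longrightarrow> E x y \<Longrightarrow> s y = - s x"
    and deg: "\<And>x. x \<in> V \<Longrightarrow> neighbours V E x \<noteq> {} \<Longrightarrow> card (neighbours V E x) = m"
    and d: "d \<le> m" "m > 0"
  obtains M where "\<And>x y. M x y \<Longrightarrow> M y x" "\<And>x y. M x y \<Longrightarrow> E x y"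
    "\<And>x. x \<in> V \<Longrightarrow> neighbours V E x \<noteq> {} \<Longrightarrow> card (neighbours V M x) = d"
proof -
  define h :: "'v \<Rightarrow> 'v \<Rightarrow> int" where
    "h x y = (if x \<in> V \<and> y \<in> V \<and> E x y then s x * int d else 0)" for x y
  define b where "b x = (if neighbours V E x \<noteq> {} then s x * int d else 0)" for x
  have h_anti: "h y x = - h x y" for x y
    using sym[of x y] sym[of y x] bip[of x y] by (auto simp: h_def)
  have h_bal: "(\<Sum>y\<in>V. h x y) = int m * b x" if x: "x \<in> V" for x
  proof -
    have "(\<Sum>y\<in>V. h x y) = (\<Sum>y\<in>neighbours V E x. h x y)"
      using fin by (intro sum_neighbours[symmetric]) (auto simp: h_def)
    also have "\<dots> = (\<Sum>y\<in>neighbours V E x. s x * int d)"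
      using x by (intro sum.cong) (auto simp: h_def neighbours_def)
    finally show ?thesis using deg[OF x] by (auto simp: b_def)
  qed
  have m_pos: "int m > 0" using d by simp
  obtain g where g: "\<And>x y. g y x = - g x y" "\<And>x y. \<bar>int m * g x y - h x y\<bar> < int m"
      "\<And>x. x \<in> V \<Longrightarrow> (\<Sum>y\<in>V. g x y) = b x"
    using integral_flow_rounding[of V "int m" h b, OF fin m_pos h_anti h_bal] by blast
  have g_0: "g x y = 0" if "h x y = 0" for x y
  proof -
    have "int m * \<bar>g x y\<bar> < int m * 1" using g(2)[of x y] that by (simp add: abs_mult)
    then show ?thesis using mult_less_cancel_left_pos[of "int m" "\<bar>g x y\<bar>" 1] d by simp
  qed
  have g_01: "g x y \<in> {0, s x}" for x y
  proof (cases "x \<in> V \<and> y \<in> V \<and> E x y")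
    case True
    have "\<bar>int m * (s x * g x y) - int d\<bar> < int m"
      using s[of x] g(2)[of x y] True by (auto simp: h_def)
    \<comment> \<open>Since \<open>d \<le> m\<close>, the bounds \<open>d - m\<close> and
      \<open>d + m\<close> lie between \<open>-m\<close> and \<open>2 * m\<close>.\<close>
    then have "int m * (s x * g x y) < int m * 2" "int m * (- 1) < int m * (s x * g x y)"
      using d by linarith+
    then have "s x * g x y < 2" "- 1 < s x * g x y"
      unfolding mult_less_cancel_left_pos[OF m_pos] .
    then have "s x * g x y = 0 \<or> s x * g x y = 1" by linarith
    then show ?thesis using s[of x] by auto
  next
    case False
    then have "h x y = 0" by (auto simp: h_def)
    then show ?thesis using g_0 by simp
  qed
  define M where "M x y \<longleftrightarrow> g x y \<noteq> 0" for x y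
  show thesis
  proof (rule that[of M])
    show "M x y \<Longrightarrow> M y x" for x y using g(1)[of x y] by (simp add: M_def)
    show "E x y" if "M x y" for x y
    proof -
      have "h x y \<noteq> 0" using g_0[of x y] that by (auto simp: M_def)
      then show ?thesis by (auto simp: h_def split: if_splits)
    qed
    fix x assume x: "x \<in> V" "neighbours V E x \<noteq> {}"
    have "s x * int d = (\<Sum>y\<in>V. g x y)" using g(3)[OF x(1)] x(2) by (simp add: b_def)
    also have "\<dots> = (\<Sum>y\<in>neighbours V M x. g x y)"
      using fin by (intro sum_neighbours[symmetric]) (auto simp: M_def)
    also have "\<dots> = (\<Sum>y\<in>neighbours V M x. s x)"
      using g_01[of x] by (intro sum.cong) (auto simp: neighbours_def M_def)
    finally show "card (neighbours V M x) = d" using s[of x] by auto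
  qed
qed

lemma card_neighbours_diff:
  assumes "finite V" "\<And>x y. M x y \<Longrightarrow> E x y"
  shows "card (neighbours V (\<lambda>x y. E x y \<and> \<not> M x y) x) =
    card (neighbours V E x) - card (neighbours V M x)"
proof -
  have "neighbours V (\<lambda>x y. E x y \<and> \<not> M x y) x = neighbours V E x - neighbours V M x"
    by (auto simp: neighbours_def)
  moreover have "neighbours V M x \<subseteq> neighbours V E x" using assms(2) by (auto simp: neighbours_def)
  ultimately show ?thesis using assms(1) by (simp add: card_Diff_subset neighbours_def)
qed

text \<open>Even valency is covered by Eulerian orientations. For odd valency a perfect matching
  carries the value 2, and a factor of the remainder is chosen so that values 1 and -1 on the other
  edges compensate for it.\<close>

lemma nz3_flowable_bipartite:
  fixes s :: "'v \<Rightarrow> int" and m :: nat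
  assumes fin: "finite V" and sym: "\<And>x y. E x y \<Longrightarrow> E y x" and irrefl: "\<And>x. \<not> E x x"
    and s: "\<And>x. s x = 1 \<or> s x = - 1" and bip: "\<And>x y. x \<in> V \<Longrightarrow> y \<in> V \<Longrightarrow> E x y \<Longrightarrow> s y = - s x"
    and deg: "\<And>x. x \<in> V \<Longrightarrow> neighbours V E x \<noteq> {} \<Longrightarrow> card (neighbours V E x) = m"
    and m: "m \<ge> 2"
  shows "nz3_flowable V E"
proof (cases "even m")
  case True
  then have "even (card (neighbours V E x))" if "x \<in> V" for x
    using deg[OF that] by (cases "neighbours V E x = {}") auto
  then show ?thesis using nz3_flowable_even_degrees[of V E, OF fin sym irrefl] by blast
next
  case False
  \<comment> \<open>An odd \<open>m \<ge> 2\<close> is at least 3, so the natural subtraction does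
    not truncate.\<close>
  then have "m = 2 * ((m - 3) div 2) + 3" using m by presburger
  then obtain p where p: "m = 2 * p + 3" by blast
  obtain M where M: "\<And>x y. M x y \<Longrightarrow> M y x" "\<And>x y. M x y \<Longrightarrow> E x y"
    "\<And>x. x \<in> V \<Longrightarrow> neighbours V E x \<noteq> {} \<Longrightarrow> card (neighbours V M x) = 1"
  proof (rule bipartite_regular_factor[of V E s m 1])
    show "E x y \<Longrightarrow> E y x" for x y by (rule sym)
    show "s x = 1 \<or> s x = - 1" for x by (rule s)
  qed (use fin bip deg m in auto)
  define E' where "E' x y \<longleftrightarrow> E x y \<and> \<not> M x y" for x y
  have cE': "card (neighbours V E' x) = 2 * p + 2" if "x \<in> V" "neighbours V E x \<noteq> {}" for x
    using card_neighbours_diff[of V M E x, OF fin M(2)] deg[OF that] M(3)[OF that] p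
    by (simp add: E'_def[abs_def])
  have nE': "neighbours V E x \<noteq> {}" if "neighbours V E' x \<noteq> {}" for x
    using that by (auto simp: E'_def neighbours_def)
  obtain L where L: "\<And>x y. L x y \<Longrightarrow> L y x" "\<And>x y. L x y \<Longrightarrow> E' x y"
    "\<And>x. x \<in> V \<Longrightarrow> neighbours V E' x \<noteq> {} \<Longrightarrow> card (neighbours V L x) = p"
  proof (rule bipartite_regular_factor[of V E' s "2 * p + 2" p])
    show "E' x y \<Longrightarrow> E' y x" for x y using sym M(1) by (auto simp: E'_def)
    show "s y = - s x" if "x \<in> V" "y \<in> V" "E' x y" for x y
      using bip that by (simp add: E'_def)
    show "card (neighbours V E' x) = 2 * p + 2" if "x \<in> V" "neighbours V E' x \<noteq> {}" for x
      using cE' nE' that by blast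
  qed (use fin s in auto)
  \<comment> \<open>Apart from the sign \<open>s x\<close>, which gives antisymmetry, a vertex sees
    one value 2, \<open>p\<close> values 1 and \<open>p + 2\<close> values -1, with sum 0.\<close>
  define f :: "'v \<Rightarrow> 'v \<Rightarrow> int" where "f x y = (if x \<in> V \<and> y \<in> V \<and> E x y
      then s x * (if M x y then 2 else if L x y then 1 else - 1) else 0)" for x y
  show ?thesis
  proof (rule nz3_flowableI[where f = f])
    show "f y x = - f x y" for x y
      using sym[of x y] sym[of y x] bip[of x y] M(1)[of x y] M(1)[of y x] L(1)[of x y] L(1)[of y x]
      by (auto simp: f_def)
  next
    fix x y assume "x \<in> V" "y \<in> V" "E x y"
    then show "f x y \<noteq> 0 \<and> \<bar>f x y\<bar> \<le> 2" using s[of x] by (auto simp: f_def)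
  next
    fix x assume x: "x \<in> V"
    show "(\<Sum>y\<in>neighbours V E x. f x y) = 0"
    proof (cases "neighbours V E x = {}")
      case ne: False
      let ?R = "neighbours V (\<lambda>x y. E' x y \<and> \<not> L x y) x"
      have cR: "card ?R = p + 2"
        using card_neighbours_diff[of V L E' x, OF fin L(2)] cE'[OF x ne] L(3)[OF x] by fastforce
      have cL: "card (neighbours V L x) = p" using cE'[OF x ne] L(3)[OF x] by fastforce
      have fin': "finite (neighbours V K x)" for K using fin by (simp add: neighbours_def)
      have "neighbours V E x = neighbours V M x \<union> (neighbours V L x \<union> ?R)"
        using M(2) L(2) by (auto simp: neighbours_def E'_def)
      then have "(\<Sum>y\<in>neighbours V E x. f x y) =
          (\<Sum>y\<in>neighbours V M x \<union> (neighbours V L x \<union> ?R). f x y)" by simp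
      also have "\<dots> = (\<Sum>y\<in>neighbours V M x. f x y) +
          ((\<Sum>y\<in>neighbours V L x. f x y) + (\<Sum>y\<in>?R. f x y))"
        using L(2) by (subst sum.union_disjoint, (auto simp: neighbours_def E'_def fin)[3])
          (subst sum.union_disjoint, auto simp: neighbours_def E'_def fin)
      also have "(\<Sum>y\<in>neighbours V M x. f x y) = (\<Sum>y\<in>neighbours V M x. s x * 2)"
        using M(2) x by (intro sum.cong) (auto simp: f_def neighbours_def)
      also have "(\<Sum>y\<in>neighbours V L x. f x y) = (\<Sum>y\<in>neighbours V L x. s x)"
        using L(2) x by (intro sum.cong) (auto simp: f_def neighbours_def E'_def)
      also have "(\<Sum>y\<in>?R. f x y) = (\<Sum>y\<in>?R. - s x)"
        using x by (intro sum.cong) (auto simp: f_def neighbours_def E'_def)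
      finally show ?thesis using M(3)[OF x ne] cL cR by (simp add: algebra_simps)
    qed simp
  qed
qed

section \<open>Involutions: two-colouring and parity\<close>

text \<open>A word of odd length in commuting involutions \<open>a\<close>, \<open>b\<close>,
  \<open>c\<close> acts as one of \<open>a\<close>, \<open>b\<close>, \<open>c\<close>,
  \<open>abc\<close>. None of these fixes a point, so there is no odd closed walk along the three
  matchings.\<close>

lemma three_commuting_involutions_coloring:
  assumes fin: "finite Q"
    and closed: "\<And>x. x \<in> Q \<Longrightarrow> a x \<in> Q" "\<And>x. x \<in> Q \<Longrightarrow> b x \<in> Q" "\<And>x. x \<in> Q \<Longrightarrow> c x \<in> Q"
    and comm: "\<And>x. x \<in> Q \<Longrightarrow> b (a x) = a (b x)" "\<And>x. x \<in> Q \<Longrightarrow> c (a x) = a (c x)"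
      "\<And>x. x \<in> Q \<Longrightarrow> c (b x) = b (c x)"
    and inv: "\<And>x. x \<in> Q \<Longrightarrow> a (a x) = x" "\<And>x. x \<in> Q \<Longrightarrow> b (b x) = x" "\<And>x. x \<in> Q \<Longrightarrow> c (c x) = x"
    and fix_free: "\<And>x. x \<in> Q \<Longrightarrow> a x \<noteq> x" "\<And>x. x \<in> Q \<Longrightarrow> b x \<noteq> x" "\<And>x. x \<in> Q \<Longrightarrow> c x \<noteq> x"
      "\<And>x. x \<in> Q \<Longrightarrow> a (b (c x)) \<noteq> x"
  obtains s :: "'a \<Rightarrow> int" where "\<And>x. s x = 1 \<or> s x = - 1"
    "\<And>x. x \<in> Q \<Longrightarrow> s (a x) = - s x" "\<And>x. x \<in> Q \<Longrightarrow> s (b x) = - s x" "\<And>x. x \<in> Q \<Longrightarrow> s (c x) = - s x"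
proof -
  \<comment> \<open>Orbits of the even subgroup generated by ab, bc and ac; each of a, b, c swaps them in pairs.\<close>
  define \<kappa> where "\<kappa> x = {x, a (b x), b (c x), a (c x)}" for x
  obtain rank :: "'a set \<Rightarrow> nat" where rank: "inj_on rank (\<kappa> ` Q)"
    using finite_imp_inj_to_nat_seg[OF finite_imageI[OF fin, of \<kappa>]] by blast
  \<comment> \<open>\<open>a\<close> exchanges two distinct even orbits; an arbitrary injective
    ranking decides which of the two gets the sign 1.\<close>
  define s :: "'a \<Rightarrow> int" where "s x = (if rank (\<kappa> x) < rank (\<kappa> (a x)) then 1 else - 1)" for x
  have \<kappa>_a: "\<kappa> (a x) = {a x, b x, c x, a (b (c x))}" if "x \<in> Q" for x
    using that by (simp add: \<kappa>_def closed comm inv insert_commute)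
  have \<kappa>_b: "\<kappa> (b x) = \<kappa> (a x)" if "x \<in> Q" for x
    unfolding \<kappa>_a[OF that] using that by (simp add: \<kappa>_def closed comm inv insert_commute)
  have \<kappa>_c: "\<kappa> (c x) = \<kappa> (a x)" if "x \<in> Q" for x
    unfolding \<kappa>_a[OF that] using that by (simp add: \<kappa>_def closed comm inv insert_commute)
  have "rank (\<kappa> (a x)) \<noteq> rank (\<kappa> x)" if "x \<in> Q" for x
  proof -
    have "x \<in> \<kappa> x" by (simp add: \<kappa>_def)
    moreover have "x \<notin> \<kappa> (a x)" unfolding \<kappa>_a[OF that] using that fix_free[of x] by auto
    ultimately show ?thesis using rank closed(1) that by (metis image_eqI inj_on_eq_iff)
  qed
  then have flip: "s y = - s x" if "x \<in> Q" "\<kappa> y = \<kappa> (a x)" "\<kappa> (a y) = \<kappa> x" for x y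
    using that by (auto simp: s_def)
  show thesis
  proof (rule that[of s])
    show "s x = 1 \<or> s x = - 1" for x by (simp add: s_def)
    fix x assume x: "x \<in> Q"
    show "s (a x) = - s x" using flip[OF x] inv(1) x by simp
    show "s (b x) = - s x" using flip[OF x \<kappa>_b[OF x]] \<kappa>_b[OF closed(2)[OF x]] inv(2) x by simp
    show "s (c x) = - s x" using flip[OF x \<kappa>_c[OF x]] \<kappa>_c[OF closed(3)[OF x]] inv(3) x by simp
  qed
qed

lemma even_card_fixpoint_free_involution:
  assumes "finite A" and "\<And>x. x \<in> A \<Longrightarrow> \<tau> x \<in> A" and "\<And>x. x \<in> A \<Longrightarrow> \<tau> (\<tau> x) = x"
    and "\<And>x. x \<in> A \<Longrightarrow> \<tau> x \<noteq> x"
  shows "even (card A)"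
  using assms
proof (induction A rule: finite_psubset_induct)
  case (psubset A)
  show ?case
  proof (cases "A = {}")
    case False
    then obtain x where x: "x \<in> A" by blast
    let ?B = "A - {x, \<tau> x}"
    have "\<tau> y \<in> ?B" if "y \<in> ?B" for y
      using that x psubset.prems(1,2) by (metis DiffD1 DiffD2 DiffI insert_iff singletonD)
    then have "even (card ?B)"
      using x psubset.prems by (intro psubset.IH) auto
    moreover have "card A = card ?B + card {x, \<tau> x}"
      using x psubset.prems(1)[OF x] psubset.hyps(1)
      by (subst card_Un_disjoint[symmetric]) (auto intro!: arg_cong[of _ _ card])
    moreover have "card {x, \<tau> x} = 2" using psubset.prems(3)[OF x] by simp
    ultimately show ?thesis by simp
  qed simp
qed

section \<open>Orbits of normal subgroups acting on a graph\<close>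

locale graph_action = group G + group_action G V \<phi>
  for G (structure) and V :: "'v set" and \<phi> +
  fixes E :: "'v \<Rightarrow> 'v \<Rightarrow> bool"
  assumes fin: "finite V"
    and E_dom: "E x y \<Longrightarrow> x \<in> V" "E x y \<Longrightarrow> y \<in> V"
    and E_sym: "E x y \<Longrightarrow> E y x"
    and E_irrefl: "\<not> E x x"
    and E_act: "g \<in> carrier G \<Longrightarrow> E x y \<Longrightarrow> E (\<phi> g x) (\<phi> g y)"
begin

text \<open>Taking the acting subset as a parameter lets orbits of different terms of the derived
  series be compared within one group action.\<close>

definition orb :: "'a set \<Rightarrow> 'v \<Rightarrow> 'v set" where
  "orb N x = (\<lambda>n. \<phi> n x) ` N"

lemma act_closed: "g \<in> carrier G \<Longrightarrow> x \<in> V \<Longrightarrow> \<phi> g x \<in> V"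
  using element_image by blast

lemma act_inv: "g \<in> carrier G \<Longrightarrow> x \<in> V \<Longrightarrow> \<phi> (inv g) (\<phi> g x) = x"
  using orbit_sym_aux by blast

lemma act_inv2: "g \<in> carrier G \<Longrightarrow> x \<in> V \<Longrightarrow> \<phi> g (\<phi> (inv g) x) = x"
  using act_inv[of "inv g" x] by simp

lemma act_one: "x \<in> V \<Longrightarrow> \<phi> \<one> x = x"
  using id_eq_one by (metis restrict_apply')

lemmas act_mult = composition_rule

lemma orb_subset: "subgroup N G \<Longrightarrow> x \<in> V \<Longrightarrow> orb N x \<subseteq> V"
  by (auto simp: orb_def act_closed subgroup.mem_carrier)

lemma orb_refl: "subgroup N G \<Longrightarrow> x \<in> V \<Longrightarrow> x \<in> orb N x"
  unfolding orb_def using subgroup.one_closed act_one by (metis image_eqI)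

lemma orb_eqI:
  assumes N: "subgroup N G" and x: "x \<in> V" and n: "n \<in> N"
  shows "orb N (\<phi> n x) = orb N x"
proof -
  have nG: "n \<in> carrier G" using N n subgroup.mem_carrier by metis
  have "\<phi> m (\<phi> n x) \<in> orb N x" if "m \<in> N" for m
    unfolding orb_def using that n x nG subgroup.m_closed[OF N that n] subgroup.mem_carrier[OF N that]
    by (metis act_mult image_eqI)
  moreover have "\<phi> m x \<in> orb N (\<phi> n x)" if m: "m \<in> N" for m
  proof -
    have mG: "m \<in> carrier G" using N m subgroup.mem_carrier by metis
    have "\<phi> (m \<otimes> inv n) (\<phi> n x) = \<phi> m x"
      using act_mult[of "\<phi> n x" m "inv n"] mG nG x by (simp add: act_closed act_inv)
    moreover have "m \<otimes> inv n \<in> N"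
      using N m n by (simp add: subgroup.m_closed subgroup.m_inv_closed)
    ultimately show ?thesis unfolding orb_def by (metis image_eqI)
  qed
  ultimately show ?thesis by (auto simp: orb_def)
qed

lemma orb_eq_iff:
  assumes "subgroup N G" "x \<in> V" "y \<in> V"
  shows "orb N x = orb N y \<longleftrightarrow> (\<exists>n\<in>N. \<phi> n x = y)"
proof
  assume "orb N x = orb N y"
  then have "y \<in> orb N x" using orb_refl[OF assms(1,3)] by simp
  then show "\<exists>n\<in>N. \<phi> n x = y" by (auto simp: orb_def)
qed (use orb_eqI[OF assms(1,2)] in auto)

text \<open>Normality lets \<open>g\<close> pass \<open>N\<close> by conjugation, so
  \<open>N\<close>-orbits are blocks and \<open>G\<close> permutes them.\<close>

lemma orb_act:
  assumes N: "N \<lhd> G" and g: "g \<in> carrier G" and x: "x \<in> V"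
  shows "orb N (\<phi> g x) = \<phi> g ` orb N x"
proof -
  have sub: "subgroup N G" using N normal_imp_subgroup by blast
  have "\<phi> n (\<phi> g x) \<in> \<phi> g ` orb N x" if n: "n \<in> N" for n
  proof -
    have nG: "n \<in> carrier G" using sub n subgroup.mem_carrier by metis
    have "inv g \<otimes> n \<otimes> g \<in> N" using normal.inv_op_closed1[OF N g n] .
    moreover have "\<phi> g (\<phi> (inv g \<otimes> n \<otimes> g) x) = \<phi> n (\<phi> g x)"
      using g nG x by (simp add: act_mult act_closed act_inv2)
    ultimately show ?thesis unfolding orb_def by (metis image_eqI)
  qed
  moreover have "\<phi> g (\<phi> n x) \<in> orb N (\<phi> g x)" if n: "n \<in> N" for n
  proof -
    have nG: "n \<in> carrier G" using sub n subgroup.mem_carrier by metis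
    have "g \<otimes> n \<otimes> inv g \<in> N" using normal.inv_op_closed2[OF N g n] .
    moreover have "\<phi> (g \<otimes> n \<otimes> inv g) (\<phi> g x) = \<phi> g (\<phi> n x)"
      using g nG x by (simp add: act_mult act_closed act_inv)
    ultimately show ?thesis unfolding orb_def by (metis image_eqI)
  qed
  ultimately show ?thesis unfolding orb_def by blast
qed

lemma orb_act_cancel:
  assumes "N \<lhd> G" "g \<in> carrier G" "x \<in> V" "y \<in> V"
  shows "orb N (\<phi> g x) = orb N (\<phi> g y) \<longleftrightarrow> orb N x = orb N y"
proof
  assume "orb N (\<phi> g x) = orb N (\<phi> g y)"
  then have "\<phi> (inv g) ` orb N (\<phi> g x) = \<phi> (inv g) ` orb N (\<phi> g y)" by simp
  then show "orb N x = orb N y"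
    using assms by (simp add: orb_act[of N "inv g", symmetric] act_closed act_inv)
qed (use assms orb_act in simp)

text \<open>The products \<open>m n\<close> and \<open>n m\<close> differ by a commutator, which
  moves points only within orbits of the derived subgroup. Thus \<open>N\<close> acts on those
  orbits as an abelian group.\<close>

lemma orb_derived_commute:
  assumes N: "N \<lhd> G" and m: "m \<in> N" and n: "n \<in> N" and x: "x \<in> V"
  shows "orb (derived G N) (\<phi> m (\<phi> n x)) = orb (derived G N) (\<phi> n (\<phi> m x))"
proof -
  have sub: "subgroup N G" using N normal_imp_subgroup by blast
  have G: "m \<in> carrier G" "n \<in> carrier G" using sub m n subgroup.mem_carrier by metis+
  have "m \<otimes> n \<otimes> inv m \<otimes> inv n \<in> derived G N"
    unfolding derived_def using m n by (intro generate.incl) auto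
  moreover have "\<phi> (m \<otimes> n \<otimes> inv m \<otimes> inv n) (\<phi> n (\<phi> m x)) = \<phi> m (\<phi> n x)"
    using G x by (simp add: act_mult act_closed act_inv)
  moreover have "subgroup (derived G N) G"
    using derived_is_subgroup sub subgroup.subset by blast
  ultimately show ?thesis using orb_eqI[of "derived G N" "\<phi> n (\<phi> m x)"] G x act_closed by metis
qed

section \<open>Edges inside orbits: abelian quotients\<close>

text \<open>The \<open>N\<close>-translates of three well-chosen edges at \<open>x0\<close> form a
  cubic graph \<open>T\<close>, whose bipartition is found on the \<open>H\<close>-orbits. Removing
  \<open>T\<close> leaves the even degrees \<open>k - 3\<close> on the orbit of
  \<open>x0\<close>.\<close>

lemma nz3_flowable_abelian_orbit:
  assumes N: "N \<lhd> G" and H: "H \<lhd> G"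
    and comm: "\<And>m n x. m \<in> N \<Longrightarrow> n \<in> N \<Longrightarrow> x \<in> V \<Longrightarrow>
      orb H (\<phi> m (\<phi> n x)) = orb H (\<phi> n (\<phi> m x))"
    and inside: "\<And>x y. E x y \<Longrightarrow> orb N x = orb N y"
    and apart: "\<And>x y. E x y \<Longrightarrow> orb H x \<noteq> orb H y"
    and cover: "\<And>x y z. E x y \<Longrightarrow> E x z \<Longrightarrow> orb H y = orb H z \<Longrightarrow> y = z"
    and invol: "\<And>x y n. E x y \<Longrightarrow> n \<in> N \<Longrightarrow> \<phi> n x = y \<Longrightarrow> \<phi> n y = x"
    and deg: "\<And>x. x \<in> V \<Longrightarrow> card (neighbours V E x) = k" and k: "odd k" "k \<ge> 4"
    and x0: "x0 \<in> V"
  shows "nz3_flowable V (\<lambda>x y. E x y \<and> x \<in> orb N x0)"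
proof -
  let ?r = "orb H" and ?nb = "neighbours V E x0"
  have subN: "subgroup N G" using N normal_imp_subgroup by blast
  have NG: "n \<in> carrier G" if "n \<in> N" for n using subN that subgroup.mem_carrier by metis
  have NV: "\<phi> n x \<in> V" if "n \<in> N" "x \<in> V" for n x using that NG act_closed by blast
  have finN: "finite (neighbours V K x)" for K x using fin by (simp add: neighbours_def)
  have step: "\<exists>n\<in>N. \<phi> n x = y" if "E x y" for x y
    using inside[OF that] orb_eq_iff[OF subN] E_dom that by blast
  obtain y1 where y1: "y1 \<in> ?nb"
    using deg[OF x0] k by fastforce
  obtain y2 where y2: "y2 \<in> ?nb" "y2 \<noteq> y1"
  proof -
    have "card (?nb - {y1}) > 0" using deg[OF x0] k y1 finN by simp
    then have "?nb - {y1} \<noteq> {}" by fastforce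
    then show thesis using that by blast
  qed
  obtain p1 p2 where p12: "p1 \<in> N" "\<phi> p1 x0 = y1" "p2 \<in> N" "\<phi> p2 x0 = y2"
    using step y1 y2 by (metis (mono_tags, lifting) mem_Collect_eq neighbours_def)
  \<comment> \<open>The last condition will make \<open>p1 p2 p3\<close> fixed-point-free on
    \<open>H\<close>-orbits. By \<open>cover\<close> it excludes at most one neighbour, so with
    \<open>y1\<close> and \<open>y2\<close> at most three are excluded, and \<open>k \<ge> 4\<close>
    leaves a choice.\<close>
  obtain y3 where y3: "y3 \<in> ?nb" "y3 \<noteq> y1" "y3 \<noteq> y2" "?r y3 \<noteq> ?r (\<phi> p1 y2)"
  proof -
    let ?B = "{y\<in>?nb. ?r y = ?r (\<phi> p1 y2)}"
    have "finite ?B" using finN by simp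
    then have "card ?B \<le> Suc 0" unfolding card_le_Suc0_iff_eq[OF \<open>finite ?B\<close>]
      using cover[of x0] by (simp add: neighbours_def)
    moreover have "card ({y1, y2} \<union> ?B) \<le> card {y1, y2} + card ?B" by (rule card_Un_le)
    moreover have "card {y1, y2} = 2" using y2 by simp
    ultimately have "card ({y1, y2} \<union> ?B) < card ?nb" using deg[OF x0] k by linarith
    then have "\<not> ?nb \<subseteq> {y1, y2} \<union> ?B"
      using card_mono[of "{y1, y2} \<union> ?B" ?nb] finN by (simp add: not_le) (meson leD)
    then show thesis using that by blast
  qed
  obtain p3 where p3: "p3 \<in> N" "\<phi> p3 x0 = y3"
    using step y3 by (metis (mono_tags, lifting) mem_Collect_eq neighbours_def)
  define Y where "Y = {y1, y2, y3}"
  have Y: "y \<in> V" "E x0 y" if "y \<in> Y" for y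
    using that y1 y2 y3 by (auto simp: Y_def neighbours_def)
  have Y_p: "\<exists>p\<in>{p1, p2, p3}. \<phi> p x0 = y \<and> p \<in> N" if "y \<in> Y" for y
    using that p12 p3 by (auto simp: Y_def)
  define T where "T x y \<longleftrightarrow> (\<exists>p\<in>N. \<exists>z\<in>Y. x = \<phi> p x0 \<and> y = \<phi> p z)" for x y
  have T_E: "E x y" if "T x y" for x y
    using that Y(2) E_act NG unfolding T_def by blast
  have T_sym: "T y x" if xy: "T x y" for x y
  proof -
    obtain p z where p: "p \<in> N" "z \<in> Y" "x = \<phi> p x0" "y = \<phi> p z"
      using xy unfolding T_def by blast
    obtain n where n: "n \<in> N" "\<phi> n x0 = z" using Y_p[OF p(2)] by blast
    have "\<phi> n z = x0" using invol[OF Y(2)[OF p(2)] n] .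
    \<comment> \<open>As \<open>n\<close> swaps \<open>x0\<close> and \<open>z\<close>, translating
      by \<open>p n\<close> instead of \<open>p\<close> reverses the arc.\<close>
    then have "y = \<phi> (p \<otimes> n) x0" "x = \<phi> (p \<otimes> n) z"
      using act_mult NG p n x0 Y(1) by simp_all
    then show ?thesis unfolding T_def using subgroup.m_closed[OF subN p(1) n(1)] p(2) by blast
  qed
  have T_nb: "neighbours V T (\<phi> p x0) = \<phi> p ` Y" if p: "p \<in> N" for p
  proof -
    \<comment> \<open>Translates of the star that share a centre coincide: moving \<open>n\<close>
      past \<open>q\<close> and \<open>p\<close> shows that both points lie in one
      \<open>H\<close>-orbit, and \<open>cover\<close> identifies neighbours of a common
      vertex.\<close>
    have same: "\<phi> q z = \<phi> p z" if q: "q \<in> N" "\<phi> q x0 = \<phi> p x0" and z: "z \<in> Y" for q z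
    proof -
      obtain n where n: "n \<in> N" "\<phi> n x0 = z" using Y_p[OF z] by blast
      have "?r (\<phi> q z) = ?r (\<phi> n (\<phi> q x0))" using comm[OF q(1) n(1) x0] n by simp
      also have "\<dots> = ?r (\<phi> p z)" using comm[OF p n(1) x0] n q by simp
      finally show ?thesis
        by (rule cover[OF E_act[OF NG[OF q(1)] Y(2)[OF z], unfolded q(2)] E_act[OF NG[OF p] Y(2)[OF z]]])
    qed
    show ?thesis
    proof (intro equalityI subsetI)
      fix y assume "y \<in> neighbours V T (\<phi> p x0)"
      then obtain q z where "q \<in> N" "z \<in> Y" "\<phi> q x0 = \<phi> p x0" "y = \<phi> q z"
        unfolding neighbours_def T_def by auto
      then show "y \<in> \<phi> p ` Y" using same by blast
    next
      fix y assume "y \<in> \<phi> p ` Y"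
      then show "y \<in> neighbours V T (\<phi> p x0)"
        using p NV[OF p] Y(1) by (auto simp: neighbours_def T_def)
    qed
  qed
  have T_out: "neighbours V T x = {}" if "x \<notin> orb N x0" for x
    using that unfolding neighbours_def T_def orb_def by blast
  have T_deg: "card (neighbours V T x) = 3" if x: "x \<in> orb N x0" for x
  proof -
    obtain p where p: "p \<in> N" "x = \<phi> p x0" using x by (auto simp: orb_def)
    have "inj_on (\<phi> p) Y" using inj_prop[OF NG[OF p(1)]] Y(1) by (meson inj_on_subset subsetI)
    moreover have "card Y = 3" using y2 y3 by (simp add: Y_def)
    ultimately show ?thesis using T_nb[OF p(1)] p(2) by (simp add: card_image)
  qed

  \<comment> \<open>On the \<open>H\<close>-orbits inside the \<open>N\<close>-orbit of
    \<open>x0\<close>, the elements \<open>p1\<close>, \<open>p2\<close>, \<open>p3\<close> act as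
    commuting fixed-point-free involutions, ready for the two-colouring.\<close>
  define Q where "Q = ?r ` orb N x0"
  have Q: "\<exists>p\<in>N. c = ?r (\<phi> p x0)" if "c \<in> Q" for c using that by (auto simp: Q_def orb_def)
  have Q_act: "\<phi> n ` ?r (\<phi> p x0) = ?r (\<phi> n (\<phi> p x0))" if "n \<in> N" "p \<in> N" for n p
    using orb_act[OF H NG[OF that(1)]] NV[OF that(2) x0] by simp
  have Q_closed: "\<phi> n ` c \<in> Q" if "n \<in> N" "c \<in> Q" for n c
  proof -
    obtain p where p: "p \<in> N" "c = ?r (\<phi> p x0)" using Q \<open>c \<in> Q\<close> by blast
    have "\<phi> n (\<phi> p x0) = \<phi> (n \<otimes> p) x0" using act_mult NG p that x0 by simp
    then show ?thesis using Q_act[OF that(1) p(1)] p(2) subgroup.m_closed[OF subN that(1) p(1)]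
      by (auto simp: Q_def orb_def)
  qed
  have Q_comm: "\<phi> m ` (\<phi> n ` c) = \<phi> n ` (\<phi> m ` c)" if "m \<in> N" "n \<in> N" "c \<in> Q" for m n c
  proof -
    obtain p where p: "p \<in> N" "c = ?r (\<phi> p x0)" using Q \<open>c \<in> Q\<close> by blast
    show ?thesis unfolding p(2) Q_act[OF that(1) p(1)] Q_act[OF that(2) p(1)]
      using orb_act[OF H] NG comm NV that p x0 by metis
  qed
  have swap: "?r (\<phi> n (\<phi> p x0)) = ?r (\<phi> p y)" if "n \<in> N" "p \<in> N" "\<phi> n x0 = y" for n p y
    using comm[OF that(1,2) x0] that(3) by simp
  have Q_inv: "\<phi> n ` (\<phi> n ` c) = c" if "n \<in> N" "\<phi> n x0 \<in> Y" "c \<in> Q" for n c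
  proof -
    obtain p where p: "p \<in> N" "c = ?r (\<phi> p x0)" using Q \<open>c \<in> Q\<close> by blast
    have "\<phi> n ` (\<phi> n ` c) = \<phi> n ` ?r (\<phi> p (\<phi> n x0))"
      unfolding p(2) using Q_act[OF that(1) p(1)] swap[OF that(1) p(1)] by simp
    also have "\<dots> = ?r (\<phi> n (\<phi> p (\<phi> n x0)))"
      using orb_act[OF H NG[OF that(1)]] NV that p x0 by simp
    also have "\<dots> = ?r (\<phi> p (\<phi> n (\<phi> n x0)))" using comm that p NV x0 by blast
    also have "\<phi> n (\<phi> n x0) = x0" using invol[OF Y(2)[OF that(2)] that(1)] by simp
    finally show ?thesis using p(2) by simp
  qed
  have Q_free: "\<phi> n ` c \<noteq> c" if "n \<in> N" "\<phi> n x0 \<in> Y" "c \<in> Q" for n c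
  proof -
    obtain p where p: "p \<in> N" "c = ?r (\<phi> p x0)" using Q \<open>c \<in> Q\<close> by blast
    \<comment> \<open>The translate by \<open>p\<close> of the edge from \<open>x0\<close> to
      \<open>n x0\<close> joins these two orbits.\<close>
    have "?r (\<phi> p x0) \<noteq> ?r (\<phi> p (\<phi> n x0))"
      using apart E_act[OF NG[OF p(1)] Y(2)[OF that(2)]] by blast
    then show ?thesis unfolding p(2) using Q_act[OF that(1) p(1)] swap[OF that(1) p(1)] by simp
  qed
  have pY: "\<phi> p1 x0 \<in> Y" "\<phi> p2 x0 \<in> Y" "\<phi> p3 x0 \<in> Y" using p12 p3 by (auto simp: Y_def)
  have Q_free3: "\<phi> p1 ` (\<phi> p2 ` (\<phi> p3 ` c)) \<noteq> c" if c: "c \<in> Q" for c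
  proof
    assume *: "\<phi> p1 ` (\<phi> p2 ` (\<phi> p3 ` c)) = c"
    obtain p where p: "p \<in> N" "c = ?r (\<phi> p x0)" using Q c by blast
    \<comment> \<open>As \<open>p3\<close> is an involution on \<open>Q\<close>, a point fixed by
      \<open>p1 p2 p3\<close> has the same image under \<open>p3\<close> and \<open>p1 p2\<close>.
      Cancelling the translation by \<open>p\<close> puts \<open>y3\<close> into the excluded
      \<open>H\<close>-orbit of \<open>p1 y2\<close>.\<close>
    have "\<phi> p3 ` c = \<phi> p3 ` (\<phi> p1 ` (\<phi> p2 ` (\<phi> p3 ` c)))" using * by simp
    also have "\<dots> = \<phi> p1 ` (\<phi> p2 ` (\<phi> p3 ` (\<phi> p3 ` c)))"
      using Q_comm Q_closed p12(1,3) p3(1) c by metis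
    also have "\<dots> = \<phi> p1 ` (\<phi> p2 ` c)" using Q_inv[OF p3(1) pY(3) c] by simp
    finally have "?r (\<phi> p y3) = \<phi> p1 ` ?r (\<phi> p y2)"
      unfolding p(2) using Q_act p12 p3 p(1) swap by metis
    also have "\<dots> = ?r (\<phi> p (\<phi> p1 y2))"
      using orb_act[OF H NG[OF p12(1)]] comm[OF p12(1) p(1)] NV[OF p(1)] y2 by (simp add: neighbours_def)
    finally have "?r y3 = ?r (\<phi> p1 y2)"
      using orb_act_cancel[OF H NG[OF p(1)]] NV[OF p12(1)] y2 y3 by (simp add: neighbours_def)
    then show False using y3 by simp
  qed
  have "finite Q" unfolding Q_def
    using orb_subset[OF subN x0] fin finite_subset by blast
  then obtain s :: "'v set \<Rightarrow> int" where s: "\<And>c. s c = 1 \<or> s c = - 1"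
    and s_flip: "\<And>c. c \<in> Q \<Longrightarrow> s (\<phi> p1 ` c) = - s c" "\<And>c. c \<in> Q \<Longrightarrow> s (\<phi> p2 ` c) = - s c"
      "\<And>c. c \<in> Q \<Longrightarrow> s (\<phi> p3 ` c) = - s c"
    using three_commuting_involutions_coloring[OF _ Q_closed[OF p12(1)] Q_closed[OF p12(3)]
      Q_closed[OF p3(1)] Q_comm[OF p12(3,1)] Q_comm[OF p3(1) p12(1)] Q_comm[OF p3(1) p12(3)]
      Q_inv[OF p12(1) pY(1)] Q_inv[OF p12(3) pY(2)] Q_inv[OF p3(1) pY(3)]
      Q_free[OF p12(1) pY(1)] Q_free[OF p12(3) pY(2)] Q_free[OF p3(1) pY(3)] Q_free3]
    by blast

  have T_bip: "s (?r y) = - s (?r x)" if xy: "T x y" for x y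
  proof -
    obtain p z where p: "p \<in> N" "z \<in> Y" "x = \<phi> p x0" "y = \<phi> p z"
      using xy unfolding T_def by blast
    obtain n where n: "n \<in> {p1, p2, p3}" "n \<in> N" "\<phi> n x0 = z" using Y_p[OF p(2)] by blast
    have "?r y = \<phi> n ` ?r x" using Q_act[OF n(2) p(1)] swap[OF n(2) p(1) n(3)] p by simp
    moreover have "?r x \<in> Q" using p by (auto simp: Q_def orb_def)
    ultimately show ?thesis using s_flip n(1) by auto
  qed

  have orbE: "x \<in> orb N x0 \<longleftrightarrow> y \<in> orb N x0" if "E x y" for x y
  proof -
    have "z \<in> orb N x0 \<longleftrightarrow> orb N z = orb N x0" if "z \<in> V" for z
      using orb_refl[OF subN that] orb_eqI[OF subN x0] by (auto simp: orb_def)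
    then show ?thesis using inside[OF that] E_dom[OF that] by simp
  qed
  have T_orb: "x \<in> orb N x0" if "T x y" for x y using that by (auto simp: T_def orb_def)
  let ?EO = "\<lambda>x y. E x y \<and> x \<in> orb N x0"
  show ?thesis
  \<comment> \<open>With the truth value of \<open>T\<close> as label there are two classes: the
    cubic bipartite graph and the even remainder.\<close>
  proof (rule nz3_flowable_edge_partition[OF fin, where label = T])
    show "T y x = T x y" for x y using T_sym by blast
    fix c
    show "nz3_flowable V (\<lambda>x y. ?EO x y \<and> T x y = c)"
    proof (cases c)
      case True
      have eq: "(\<lambda>x y. ?EO x y \<and> T x y = c) = T" using True T_E T_orb by blast
      show ?thesis unfolding eq
      proof (rule nz3_flowable_bipartite[OF fin, where s = "\<lambda>x. s (?r x)" and m = 3])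
        show "card (neighbours V T x) = 3" if "neighbours V T x \<noteq> {}" for x
          using T_deg T_out that by blast
        show "\<not> T x x" for x using T_E E_irrefl by blast
      qed (use T_sym T_bip s in auto)
    next
      case False
      have eq: "(\<lambda>x y. ?EO x y \<and> T x y = c) = (\<lambda>x y. ?EO x y \<and> \<not> T x y)" using False by simp
      show ?thesis unfolding eq
      proof (rule nz3_flowable_even_degrees[OF fin])
        show "?EO y x \<and> \<not> T y x" if "?EO x y \<and> \<not> T x y" for x y
          using that orbE E_sym T_sym by blast
        show "\<not> (?EO x x \<and> \<not> T x x)" for x using E_irrefl by blast
        fix x assume x: "x \<in> V"
        have "card (neighbours V (\<lambda>x y. ?EO x y \<and> \<not> T x y) x) =
            card (neighbours V ?EO x) - card (neighbours V T x)"
          using T_E T_orb by (intro card_neighbours_diff[OF fin]) blast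
        moreover have "neighbours V ?EO x = (if x \<in> orb N x0 then neighbours V E x else {})"
          by (auto simp: neighbours_def)
        ultimately show "even (card (neighbours V (\<lambda>x y. ?EO x y \<and> \<not> T x y) x))"
          using T_deg[of x] T_out[of x] deg[OF x] k by auto
      qed
    qed
  qed
qed

text \<open>If no element of \<open>N\<close> swapped \<open>x\<close> with a neighbour, pairing the
  neighbours \<open>n x\<close> and \<open>inv n x\<close> would make the odd valency even. One
  swapped edge spreads to all edges by arc-transitivity, and then each \<open>N\<close>-orbit is
  treated separately.\<close>

lemma nz3_flowable_abelian_cover:
  assumes N: "N \<lhd> G" and H: "H \<lhd> G"
    and comm: "\<And>m n x. m \<in> N \<Longrightarrow> n \<in> N \<Longrightarrow> x \<in> V \<Longrightarrow>
      orb H (\<phi> m (\<phi> n x)) = orb H (\<phi> n (\<phi> m x))"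
    and inside: "\<And>x y. E x y \<Longrightarrow> orb N x = orb N y"
    and apart: "\<And>x y. E x y \<Longrightarrow> orb H x \<noteq> orb H y"
    and cover: "\<And>x y z. E x y \<Longrightarrow> E x z \<Longrightarrow> orb H y = orb H z \<Longrightarrow> y = z"
    and deg: "\<And>x. x \<in> V \<Longrightarrow> card (neighbours V E x) = k" and k: "odd k" "k \<ge> 4"
    and arc_trans: "\<And>x y u v. E x y \<Longrightarrow> E u v \<Longrightarrow> \<exists>g\<in>carrier G. \<phi> g x = u \<and> \<phi> g y = v"
  shows "nz3_flowable V E"
proof -
  have subN: "subgroup N G" using N normal_imp_subgroup by blast
  have NG: "n \<in> carrier G" if "n \<in> N" for n using subN that subgroup.mem_carrier by metis
  have NV: "\<phi> n x \<in> V" if "n \<in> N" "x \<in> V" for n x using that NG act_closed by blast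
  have step: "\<exists>n\<in>N. \<phi> n x = y" if "E x y" for x y
    using inside[OF that] orb_eq_iff[OF subN] E_dom that by blast
  have swapped: "\<exists>y n. E x y \<and> n \<in> N \<and> \<phi> n x = y \<and> \<phi> n y = x" if x: "x \<in> V" for x
  proof (rule ccontr)
    assume none: "\<not> ?thesis"
    \<comment> \<open>If \<open>y\<close> is \<open>n x\<close>, its opposite is
      \<open>inv n x\<close>.\<close>
    define opposite where "opposite y z \<longleftrightarrow> E x y \<and> (\<exists>n\<in>N. \<phi> n x = y \<and> \<phi> n z = x) \<and> z \<in> V" for y z
    have ex: "\<exists>z. opposite y z" if y: "E x y" for y
    proof -
      obtain n where n: "n \<in> N" "\<phi> n x = y" using step[OF y] by blast
      have "\<phi> n (\<phi> (inv n) x) = x" "\<phi> (inv n) x \<in> V"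
        using act_inv2 act_closed NG n x by auto
      then show ?thesis unfolding opposite_def using n y by blast
    qed
    have opposite_sym: "opposite z y" if yz: "opposite y z" for y z
    proof -
      obtain n where n: "n \<in> N" "\<phi> n x = y" "\<phi> n z = x" "z \<in> V" "E x y"
        using yz unfolding opposite_def by blast
      have i: "inv n \<in> N" using subgroup.m_inv_closed[OF subN n(1)] .
      have "\<phi> (inv n) x = z" "\<phi> (inv n) y = x" using act_inv NG n x by auto
      moreover have "E x z" using E_act[OF NG[OF i] n(5)] calculation E_sym by simp
      ultimately show ?thesis unfolding opposite_def using i E_dom n(5) by blast
    qed
    have unique: "z = z'" if zz: "opposite y z" "opposite y z'" for y z z'
    proof -
      obtain n where n: "n \<in> N" "\<phi> n x = y" "\<phi> n z = x" "z \<in> V"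
        using zz(1) unfolding opposite_def by blast
      obtain m where m: "m \<in> N" "\<phi> m x = y" "\<phi> m z' = x" "z' \<in> V"
        using zz(2) unfolding opposite_def by blast
      \<comment> \<open>The opposite does not depend on the chosen element of \<open>N\<close>:
        commuting \<open>n\<close> and \<open>m\<close> puts both candidates into one
        \<open>H\<close>-orbit, and both are neighbours of \<open>x\<close>.\<close>
      have "orb H (\<phi> n (\<phi> m z')) = orb H (\<phi> m (\<phi> n z))" using n m by simp
      also have "\<dots> = orb H (\<phi> n (\<phi> m z))" using comm n m by blast
      finally have "orb H (\<phi> m z') = orb H (\<phi> m z)"
        by (subst (asm) orb_act_cancel[OF H NG[OF n(1)]]) (use n m NV in auto)
      then have "orb H z' = orb H z" using orb_act_cancel[OF H NG[OF m(1)] m(4) n(4)] by blast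
      moreover have "E x z" "E x z'" using opposite_sym zz unfolding opposite_def by blast+
      ultimately show ?thesis using cover by metis
    qed
    define \<tau> where "\<tau> y = (SOME z. opposite y z)" for y
    have \<tau>: "opposite y (\<tau> y)" if "E x y" for y
      unfolding \<tau>_def using someI_ex[OF ex[OF that]] .
    have "even (card (neighbours V E x))"
    proof (rule even_card_fixpoint_free_involution[where \<tau> = \<tau>])
      show "finite (neighbours V E x)" using fin by (simp add: neighbours_def)
      fix y assume "y \<in> neighbours V E x"
      then have y: "E x y" by (simp add: neighbours_def)
      have E\<tau>: "E x (\<tau> y)" using opposite_sym[OF \<tau>[OF y]] unfolding opposite_def by blast
      then show "\<tau> y \<in> neighbours V E x" using E_dom by (simp add: neighbours_def)
      show "\<tau> (\<tau> y) = y" using unique[OF \<tau>[OF E\<tau>] opposite_sym[OF \<tau>[OF y]]] .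
      show "\<tau> y \<noteq> y" using \<tau>[OF y] none unfolding opposite_def by metis
    qed
    then show False using deg[OF x] k by simp
  qed
  have invol: "\<phi> m v = u" if uv: "E u v" and m: "m \<in> N" "\<phi> m u = v" for u v m
  proof -
    obtain y n where y: "E u y" "n \<in> N" "\<phi> n u = y" "\<phi> n y = u"
      using swapped E_dom(1)[OF uv] by blast
    obtain g where g: "g \<in> carrier G" "\<phi> g u = u" "\<phi> g y = v" using arc_trans[OF y(1) uv] by blast
    \<comment> \<open>The conjugate swaps \<open>u\<close> and \<open>v\<close>. Any other
      \<open>m\<close> taking \<open>u\<close> to \<open>v\<close> commutes with it modulo
      \<open>H\<close>, so \<open>m v\<close> and \<open>u\<close> are neighbours of
      \<open>v\<close> in one \<open>H\<close>-orbit.\<close>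
    let ?n = "g \<otimes> n \<otimes> inv g"
    have V: "u \<in> V" "v \<in> V" "y \<in> V" using E_dom uv y by blast+
    have n: "?n \<in> N" using normal.inv_op_closed2[OF N g(1) y(2)] .
    have "\<phi> (inv g) u = u" "\<phi> (inv g) v = y" using act_inv g V by metis+
    then have n_uv: "\<phi> ?n u = v" "\<phi> ?n v = u"
      using act_mult V g NG[OF y(2)] y act_closed by simp_all
    have "orb H (\<phi> m v) = orb H (\<phi> ?n (\<phi> m u))" using comm[OF m(1) n V(1)] n_uv by simp
    then have "orb H (\<phi> m v) = orb H u" using m n_uv by simp
    moreover have "E v (\<phi> m v)" using E_act[OF NG[OF m(1)] uv] m by simp
    ultimately show ?thesis using cover E_sym[OF uv] by blast
  qed
  show ?thesis
  proof (rule nz3_flowable_edge_partition[OF fin, where label = "\<lambda>x y. {orb N x, orb N y}"])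
    show "{orb N y, orb N x} = {orb N x, orb N y}" for x y by blast
    fix c
    show "nz3_flowable V (\<lambda>x y. E x y \<and> {orb N x, orb N y} = c)"
    proof (cases "\<exists>x0\<in>V. c = {orb N x0}")
      case True
      then obtain x0 where x0: "x0 \<in> V" "c = {orb N x0}" by blast
      have "orb N x = orb N x0 \<longleftrightarrow> x \<in> orb N x0" if "x \<in> V" for x
        using orb_refl[OF subN that] orb_eqI[OF subN x0(1)] by (auto simp: orb_def)
      then have "E x y \<and> {orb N x, orb N y} = c \<longleftrightarrow> E x y \<and> x \<in> orb N x0" for x y
        using inside[of x y, symmetric] E_dom(1)[of x y] x0(2) by (cases "E x y") simp_all
      then have eq: "(\<lambda>x y. E x y \<and> {orb N x, orb N y} = c) = (\<lambda>x y. E x y \<and> x \<in> orb N x0)"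
        by simp
      show ?thesis unfolding eq
        by (rule nz3_flowable_abelian_orbit[OF N H comm inside apart cover invol deg k x0(1)])
    next
      case False
      then have "\<not> (E x y \<and> {orb N x, orb N y} = c)" for x y
        using inside[of x y] E_dom(1)[of x y] by (metis insert_absorb2)
      then have "(\<lambda>x y. E x y \<and> {orb N x, orb N y} = c) = (\<lambda>x y. False)"
        by blast
      then show ?thesis by (simp add: nz3_flowable_even_degrees[OF fin] neighbours_def)
    qed
  qed
qed

section \<open>Several edges from a vertex into one orbit\<close>

text \<open>The edges between two fixed \<open>N\<close>-orbits form a bipartite graph.
  Arc-transitivity gives all nonempty fibres the same size \<open>m\<close>, and \<open>b\<close>,
  \<open>c\<close> witness \<open>m \<ge> 2\<close>.\<close>

lemma nz3_flowable_multicover: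
  assumes N: "N \<lhd> G"
    and apart: "\<And>x y. E x y \<Longrightarrow> orb N x \<noteq> orb N y"
    and multi: "E a b" "E a c" "b \<noteq> c" "orb N b = orb N c"
    and arc_trans: "\<And>x y u v. E x y \<Longrightarrow> E u v \<Longrightarrow> \<exists>g\<in>carrier G. \<phi> g x = u \<and> \<phi> g y = v"
  shows "nz3_flowable V E"
proof -
  define fibre where "fibre x y = {z. E x z \<and> orb N z = orb N y}" for x y
  define m where "m = card (fibre a b)"
  have fin_fibre: "finite (fibre x y)" for x y
    using fin E_dom by (auto simp: fibre_def intro: finite_subset[of _ V])
  have fibre_act: "\<phi> g ` fibre x y \<subseteq> fibre (\<phi> g x) (\<phi> g y)" if "g \<in> carrier G" "y \<in> V" for g x y
  proof
    fix w assume "w \<in> \<phi> g ` fibre x y"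
    then obtain z where z: "w = \<phi> g z" "E x z" "orb N z = orb N y" by (auto simp: fibre_def)
    then have "orb N w = orb N (\<phi> g y)"
      using orb_act_cancel[OF N that(1) E_dom(2)[OF z(2)] that(2)] by simp
    then show "w \<in> fibre (\<phi> g x) (\<phi> g y)" using E_act[OF that(1) z(2)] z(1) by (simp add: fibre_def)
  qed
  have fibre_le: "card (fibre x y) \<le> card (fibre u v)" if xy: "E x y" and uv: "E u v" for x y u v
  proof -
    obtain g where g: "g \<in> carrier G" "\<phi> g x = u" "\<phi> g y = v" using arc_trans[OF xy uv] by blast
    have "inj_on (\<phi> g) (fibre x y)"
      using inj_prop[OF g(1)] E_dom by (auto simp: fibre_def intro: inj_on_subset)
    then show ?thesis
      using fibre_act[OF g(1) E_dom(2)[OF xy], of x] g fin_fibre by (metis card_inj_on_le)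
  qed
  then have card_fibre: "card (fibre x y) = m" if "E x y" for x y
    using that multi(1) unfolding m_def by (meson le_antisym)
  have "{b, c} \<subseteq> fibre a b" using multi by (auto simp: fibre_def)
  then have m: "m \<ge> 2"
    using card_mono[OF fin_fibre, of "{b, c}" a b] multi(3) by (simp add: m_def)
  show ?thesis
  proof (rule nz3_flowable_edge_partition[OF fin, where label = "\<lambda>x y. {orb N x, orb N y}"])
    show "{orb N y, orb N x} = {orb N x, orb N y}" for x y by blast
    fix C
    let ?E = "\<lambda>x y. E x y \<and> {orb N x, orb N y} = C"
    show "nz3_flowable V ?E"
    proof (cases "\<exists>x y. ?E x y")
      case True
      then obtain x0 y0 where xy0: "E x0 y0" "C = {orb N x0, orb N y0}" by blast
      define s :: "'v \<Rightarrow> int" where "s x = (if orb N x = orb N x0 then 1 else - 1)" for x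
      show ?thesis
      proof (rule nz3_flowable_bipartite[OF fin, where s = s and m = m])
        show "?E x y \<Longrightarrow> ?E y x" for x y using E_sym by blast
        show "\<not> ?E x x" for x using E_irrefl by blast
        show "s x = 1 \<or> s x = - 1" for x by (simp add: s_def)
        show "s y = - s x" if "?E x y" for x y
          using that apart[of x y] apart[OF xy0(1)] xy0(2) by (auto simp: s_def doubleton_eq_iff)
        show "card (neighbours V ?E x) = m" if ne: "neighbours V ?E x \<noteq> {}" for x
        proof -
          obtain y where y: "?E x y" using ne by (auto simp: neighbours_def)
          \<comment> \<open>The unordered label and the orbit of \<open>x\<close> determine the
            orbit at the other end.\<close>
          have "neighbours V ?E x = fibre x y"
            using y E_dom by (auto simp: neighbours_def fibre_def doubleton_eq_iff)
          then show ?thesis using card_fibre y by simp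
        qed
      qed (rule m)
    next
      case False
      then have "?E = (\<lambda>x y. False)" by blast
      then show ?thesis by (simp add: nz3_flowable_even_degrees[OF fin] neighbours_def)
    qed
  qed
qed

section \<open>Descent along the derived series\<close>

lemma nz3_flowable_solvable:
  assumes "solvable G"
    and deg: "\<And>x. x \<in> V \<Longrightarrow> card (neighbours V E x) = k" and k: "k \<ge> 4"
    and trans: "\<And>x y. x \<in> V \<Longrightarrow> y \<in> V \<Longrightarrow> \<exists>g\<in>carrier G. \<phi> g x = y"
    and arc_trans: "\<And>x y u v. E x y \<Longrightarrow> E u v \<Longrightarrow> \<exists>g\<in>carrier G. \<phi> g x = u \<and> \<phi> g y = v"
  shows "nz3_flowable V E"
proof (cases "even k \<or> (\<forall>x y. \<not> E x y)")
  case True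
  then have "even (card (neighbours V E x))" if "x \<in> V" for x
    using deg[OF that] by (auto simp: neighbours_def)
  then show ?thesis using nz3_flowable_even_degrees[of V E, OF fin E_sym E_irrefl] by blast
next
  case False
  then obtain x0 y0 where odd: "odd k" and xy0: "E x0 y0" by blast
  define D where "D i = (derived G ^^ i) (carrier G)" for i
  have D_normal: "D i \<lhd> G" for i
    by (induction i) (auto simp: D_def normal_self derived_is_normal)
  \<comment> \<open>\<open>covers i\<close> says that the quotient by the \<open>D i\<close>-orbits
    has no loops and preserves the valency.\<close>
  define covers where "covers i \<longleftrightarrow> (\<forall>x y. E x y \<longrightarrow> orb (D i) x \<noteq> orb (D i) y) \<and>
      (\<forall>x y z. E x y \<longrightarrow> E x z \<longrightarrow> orb (D i) y = orb (D i) z \<longrightarrow> y = z)" for i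
  \<comment> \<open>\<open>D 0\<close> is the whole group; its single orbit contains every
    edge.\<close>
  have "\<not> covers 0"
    using trans[of x0 y0] orb_eq_iff[OF subgroup_self, of x0 y0] E_dom[OF xy0] xy0
    by (auto simp: covers_def D_def)
  moreover have "\<exists>n. covers n"
  proof -
    obtain n where "D n = {\<one>}"
      using solvable_imp_trivial_derived_seq assms(1) unfolding solvable_def D_def by blast
    then have "orb (D n) x = {x}" if "x \<in> V" for x using act_one[OF that] by (simp add: orb_def)
    then have "covers n" using E_dom E_irrefl unfolding covers_def by (metis singleton_inject)
    then show ?thesis by blast
  qed
  \<comment> \<open>The quotient covers for the trivial last term but not at the start, so the
    property switches between consecutive terms. Its failure at \<open>i\<close> means an edge
    inside an orbit or two neighbours in one orbit, the two cases below.\<close>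
  ultimately obtain i where i: "\<not> covers i" "covers (Suc i)"
    using ex_least_nat_less[of covers] by blast
  have D_Suc: "D (Suc i) = derived G (D i)" by (simp add: D_def)
  show ?thesis
  proof (cases "\<exists>x y. E x y \<and> orb (D i) x = orb (D i) y")
    case True
    then obtain x1 y1 where xy1: "E x1 y1" "orb (D i) x1 = orb (D i) y1" by blast
    \<comment> \<open>Arc-transitivity carries one edge inside an orbit to every edge, since
      \<open>G\<close> permutes the orbits.\<close>
    have inside: "orb (D i) x = orb (D i) y" if xy: "E x y" for x y
    proof -
      obtain g where "g \<in> carrier G" "\<phi> g x1 = x" "\<phi> g y1 = y" using arc_trans[OF xy1(1) xy] by blast
      then show ?thesis using orb_act_cancel[OF D_normal] xy1 E_dom by metis
    qed
    have apart: "orb (D (Suc i)) x \<noteq> orb (D (Suc i)) y" if "E x y" for x y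
      using i(2) that unfolding covers_def by blast
    have cover: "y = z" if "E x y" "E x z" "orb (D (Suc i)) y = orb (D (Suc i)) z" for x y z
      using i(2) that unfolding covers_def by blast
    have comm: "orb (D (Suc i)) (\<phi> m (\<phi> n x)) = orb (D (Suc i)) (\<phi> n (\<phi> m x))"
      if "m \<in> D i" "n \<in> D i" "x \<in> V" for m n x
      unfolding D_Suc using orb_derived_commute[OF D_normal that] .
    show ?thesis
      by (rule nz3_flowable_abelian_cover[OF D_normal[of i] D_normal[of "Suc i"] comm inside apart
            cover deg odd k arc_trans])
  next
    case False
    then have apart: "orb (D i) x \<noteq> orb (D i) y" if "E x y" for x y using that by blast
    obtain a b c where "E a b" "E a c" "b \<noteq> c" "orb (D i) b = orb (D i) c"
      using i(1) False unfolding covers_def by blast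
    from nz3_flowable_multicover[OF D_normal apart this arc_trans] show ?thesis .
  qed
qed

end

section \<open>Passage from the given graph and action to the abstract setting\<close>

theorem mainTheorem1:
  fixes V :: "'v set" and Adj :: "'v \<Rightarrow> 'v \<Rightarrow> bool" and k :: nat
    and G :: "('g, 'b) monoid_scheme" and \<phi> :: "'g \<Rightarrow> 'v \<Rightarrow> 'v"
  assumes "finite V"
    and "simple_graph V Adj"
    and "regular_graph V Adj k"
    and "k \<ge> 4"
    and "group G" and "finite (carrier G)" and "solvable G"
    and "acts_by_automorphisms G V Adj \<phi>"
    and "arc_transitive G V Adj \<phi>"
  shows "admits_nz_flow 3 V Adj"
proof -
  have dom: "Adj x y \<Longrightarrow> x \<in> V \<and> y \<in> V" for x y using assms(2) by (auto simp: simple_graph_def)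
  have act: "group_action G V \<phi>"
    and aut: "\<And>g x y. g \<in> carrier G \<Longrightarrow> x \<in> V \<Longrightarrow> y \<in> V \<Longrightarrow> Adj x y \<longleftrightarrow> Adj (\<phi> g x) (\<phi> g y)"
    using assms(8) unfolding acts_by_automorphisms_def by blast+
  have graph: "\<And>x y. Adj x y \<Longrightarrow> Adj y x" "\<And>x. \<not> Adj x x"
    using assms(2) unfolding simple_graph_def by blast+
  interpret graph_action G V \<phi> Adj
    by (intro graph_action.intro graph_action_axioms.intro assms(1,5) act)
      (use dom graph aut in blast)+
  have "nz3_flowable V Adj"
  proof (rule nz3_flowable_solvable[OF assms(7) _ assms(4)])
    show "card (neighbours V Adj x) = k" if "x \<in> V" for x
      using assms(3) that by (simp add: regular_graph_def)
    show "\<exists>g\<in>carrier G. \<phi> g x = y" if "x \<in> V" "y \<in> V" for x y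
      using assms(9) that by (simp add: arc_transitive_def)
    show "\<exists>g\<in>carrier G. \<phi> g x = u \<and> \<phi> g y = v" if "Adj x y" "Adj u v" for x y u v
    proof -
      have "(x, y) \<in> arcs V Adj" "(u, v) \<in> arcs V Adj" using dom that by (auto simp: arcs_def)
      then have "\<exists>g\<in>carrier G. (\<phi> g (fst (x, y)), \<phi> g (snd (x, y))) = (u, v)"
        using assms(9) unfolding arc_transitive_def by blast
      then show ?thesis by simp
    qed
  qed
  then show ?thesis using admits_nz_flow_if_nz3_flowable assms(1,2) by blast
qed

end
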